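(* Let $k\geq 1$, let $A,B$ be $k$-connected graphs, and let $f:V(A)\to V(B)$ be a function such that for every $a\in V(A)$ we have $|\{f(a') : aa'\in E(A)\}|\geq k$. Then $A\otimes_f B$ is $k$-connected.
   Context: All graphs are finite and simple. A graph $G$ is $k$-connected if it has more than $k$ vertices and removing any set of fewer than $k$ vertices leaves a connected graph. For graphs $A,B$ and a function $f:V(A)\to V(B)$, the Sierpiński product $A\otimes_f B$ is the graph with vertex set $V(A)\times V(B)$ and edge set $\{(a,b_1)(a,b_2): a\in V(A),\ b_1b_2\in E(B)\}\cup\{(a_1,f(a_2))(a_2,f(a_1)) : a_1a_2\in E(A)\}$. *)

theory Defs
  imports "Graph_Theory.Graph_Theory"
begin

text \<open>
  A finite simple graph is a \<open>pair_graph\<close>: finite vertex set, irreflexive symmetric set of arcs.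
  An undirected edge \<open>uv\<close> is thus the pair of arcs \<open>(u, v)\<close>, \<open>(v, u)\<close>.
\<close>

definition k_connected :: "nat \<Rightarrow> 'a pair_pre_digraph \<Rightarrow> bool" where
  "k_connected k G \<longleftrightarrow>
     pair_graph G \<and>
     card (pverts G) > k \<and>
     (\<forall>S \<subseteq> pverts G. card S < k \<longrightarrow> Digraph_Component.connected (with_proj G \<restriction> (pverts G - S)))"

text \<open>
  Since the arcs of \<open>A\<close> and \<open>B\<close> are symmetric, each of the two sets of arcs below already contains
  both orientations of every edge.
\<close>

definition sierpinski_product ::
  "'a pair_pre_digraph \<Rightarrow> ('a \<Rightarrow> 'b) \<Rightarrow> 'b pair_pre_digraph \<Rightarrow> ('a \<times> 'b) pair_pre_digraph" where
  "sierpinski_product A f B =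
     \<lparr> pverts = pverts A \<times> pverts B,
       parcs = {((a, b1), (a, b2)) | a b1 b2. a \<in> pverts A \<and> (b1, b2) \<in> parcs B}
             \<union> {((a1, f a2), (a2, f a1)) | a1 a2. (a1, a2) \<in> parcs A} \<rparr>"

end

theory Submission
  imports Defs
begin

text \<open>
  Delete a set \<open>S\<close> of fewer than \<open>k\<close> vertices. What remains of each fibre \<open>{a} \<times> V(B)\<close> is connected,
  since \<open>B\<close> is \<open>k\<close>-connected. Let \<open>T\<close> be the set of the first coordinates of \<open>S\<close>. As \<open>A - T\<close> is
  connected and the edges between untouched fibres survive, all untouched fibres lie in one
  component. A touched fibre over \<open>a\<close> is joined by a surviving edge to an untouched one: otherwise,
  for each neighbour \<open>a'\<close> of \<open>a\<close>, the set \<open>S\<close> contains \<open>(a, f a')\<close> or meets the fibre over \<open>a'\<close>,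
  so that \<open>a\<close> would see at most \<open>|S| < k\<close> values of \<open>f\<close>.
\<close>

text \<open>Library connectedness is strong connectedness of the symmetric closure. As
  \<open>parcs G\<close> is already symmetric, the closure adds no arc, and a walk confined to
  \<open>W\<close> uses only arcs with both ends in \<open>W\<close>, so \<open>rtrancl_on W\<close>
  can work with the arcs of \<open>G\<close> itself.\<close>

lemma connected_induce_with_proj_iff:
  assumes "pair_graph G"
  shows "Digraph_Component.connected (with_proj G \<restriction> W) \<longleftrightarrow>
    W \<noteq> {} \<and> (\<forall>u \<in> W. \<forall>v \<in> W. (u, v) \<in> rtrancl_on W (parcs G))"
proof -
  interpret pair_graph G by fact
  have "parcs (mk_symmetric (with_proj G \<restriction> W)) = {(u, v) \<in> parcs G. u \<in> W \<and> v \<in> W}"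
    using graph_symmetric by (auto simp: parcs_mk_symmetric)
  moreover have "(u, v) \<in> rtrancl_on W {(u, v) \<in> parcs G. u \<in> W \<and> v \<in> W}"
    if "(u, v) \<in> rtrancl_on W (parcs G)" for u v
    using that by (induct rule: rtrancl_on_induct) (auto intro: rtrancl_on_into_rtrancl_on)
  moreover have "(u, v) \<in> rtrancl_on W (parcs G)"
    if "(u, v) \<in> rtrancl_on W {(u, v) \<in> parcs G. u \<in> W \<and> v \<in> W}" for u v
    using rtrancl_on_mono[OF _ order_refl that] by auto
  ultimately show ?thesis
    unfolding Digraph_Component.connected_def strongly_connected_def reachable_def by auto
qed

lemma k_connectedD:
  assumes "k_connected k G"
  shows "pair_graph G" "k < card (pverts G)"
    and "S \<subseteq> pverts G \<Longrightarrow> card S < k \<Longrightarrow> u \<in> pverts G - S \<Longrightarrow> v \<in> pverts G - S \<Longrightarrow>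
      (u, v) \<in> rtrancl_on (pverts G - S) (parcs G)"
proof -
  show G: "pair_graph G" and "k < card (pverts G)"
    using assms by (auto simp: k_connected_def)
  show "S \<subseteq> pverts G \<Longrightarrow> card S < k \<Longrightarrow> u \<in> pverts G - S \<Longrightarrow> v \<in> pverts G - S \<Longrightarrow>
      (u, v) \<in> rtrancl_on (pverts G - S) (parcs G)"
    using assms unfolding k_connected_def connected_induce_with_proj_iff[OF G] by blast
qed

lemma pverts_sierpinski_product [simp]:
  "pverts (sierpinski_product A f B) = pverts A \<times> pverts B"
  by (simp add: sierpinski_product_def)

lemma parcs_sierpinski_product_iff:
  "((a1, b1), (a2, b2)) \<in> parcs (sierpinski_product A f B) \<longleftrightarrow>
    a1 = a2 \<and> a1 \<in> pverts A \<and> (b1, b2) \<in> parcs B \<or>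
    (a1, a2) \<in> parcs A \<and> b1 = f a2 \<and> b2 = f a1"
  by (auto simp: sierpinski_product_def)

lemma pair_graph_sierpinski_product:
  assumes "pair_graph A" "pair_graph B" and f: "f \<in> pverts A \<rightarrow> pverts B"
  shows "pair_graph (sierpinski_product A f B)"
proof -
  interpret A: pair_graph A by fact
  interpret B: pair_graph B by fact
  let ?P = "sierpinski_product A f B"
  have wf: "fst e \<in> pverts ?P" "snd e \<in> pverts ?P" if "e \<in> parcs ?P" for e
    using that f A.wellformed' B.wellformed'
    by (cases e; fastforce simp: parcs_sierpinski_product_iff)+
  show ?thesis
  proof
    show "finite (pverts ?P)"
      using A.pair_finite_verts B.pair_finite_verts by simp
    moreover have "parcs ?P \<subseteq> pverts ?P \<times> pverts ?P"
      using wf by (auto simp: mem_Times_iff simp del: pverts_sierpinski_product)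
    ultimately show "finite (parcs ?P)"
      using finite_subset by blast
    show "fst e \<noteq> snd e" if "e \<in> parcs ?P" for e
      using that A.no_loops'[of x x for x] B.no_loops'[of x x for x]
      by (cases e) (auto simp: parcs_sierpinski_product_iff)
    show "symmetric (with_proj ?P)"
      using A.graph_symmetric B.graph_symmetric
      by (auto simp: symmetric_def parcs_sierpinski_product_iff intro!: symI)
  qed (use wf in auto)
qed

lemma surviving_neighbour:
  fixes S :: "('a \<times> 'b) set"
  assumes "finite S" "card S < card {f a' | a'. (a, a') \<in> E}" "(a, a) \<notin> E"
  obtains a' where "(a, a') \<in> E" "(a, f a') \<notin> S" "a' \<notin> fst ` S"
proof -
  \<comment> \<open>\<open>?g\<close> charges each deleted vertex with the one value of
    \<open>f\<close> that it can block at \<open>a\<close>: a vertex \<open>(a, y)\<close> blocks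
    \<open>y\<close>, and a vertex over \<open>x \<noteq> a\<close> blocks \<open>f x\<close>. So at
    most \<open>card S\<close> values are blocked.\<close>
  let ?g = "\<lambda>(x, y). if x = a then y else f x"
  have "\<not> {f a' | a'. (a, a') \<in> E} \<subseteq> ?g ` S"
    using assms surj_card_le by (meson leD)
  then obtain a' where a': "(a, a') \<in> E" "f a' \<notin> ?g ` S"
    by auto
  moreover from this have "(a, f a') \<notin> S"
    by (auto simp: image_iff)
  moreover have "a' \<notin> fst ` S"
  proof
    assume "a' \<in> fst ` S"
    then obtain y where "(a', y) \<in> S" by auto
    \<comment> \<open>This selects the second branch of \<open>?g\<close>, so \<open>(a', y)\<close>
      is charged with \<open>f a'\<close>.\<close>
    moreover have "a' \<noteq> a" using a' assms(3) by auto
    ultimately show False using a'(2) by (auto simp: image_iff)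
  qed
  ultimately show thesis
    using that by blast
qed

text \<open>The trace \<open>U\<close> of \<open>S\<close> on the fibre over \<open>a\<close> has at
  most \<open>card S\<close> elements, so \<open>B - U\<close> is connected, and a walk there lifts
  edge by edge to the fibre.\<close>

lemma fibre_connected:
  assumes B: "k_connected k B" and "finite S" "card S < k"
    and "a \<in> pverts A" "b \<in> pverts B" "b' \<in> pverts B" "(a, b) \<notin> S" "(a, b') \<notin> S"
  shows "((a, b), (a, b')) \<in>
    rtrancl_on (pverts A \<times> pverts B - S) (parcs (sierpinski_product A f B))"
proof -
  define U where "U = {y \<in> pverts B. (a, y) \<in> S}"
  have "card U \<le> card S"
    using \<open>finite S\<close> by (intro surj_card_le[where f = snd]) (force simp: U_def)+
  then have "(b, b') \<in> rtrancl_on (pverts B - U) (parcs B)"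
    using assms by (intro k_connectedD(3)[OF B]) (auto simp: U_def)
  then show ?thesis
  proof (induct rule: rtrancl_on_induct)
    case base
    then show ?case using assms by auto
  next
    case (step y z)
    then show ?case using assms(4)
      by (intro rtrancl_on_into_rtrancl_on[OF step(5)])
        (auto simp: parcs_sierpinski_product_iff U_def)
  qed
qed

lemma untouched_fibres_connected:
  assumes A: "k_connected k A" and B: "k_connected k B"
    and f: "f \<in> pverts A \<rightarrow> pverts B" and S: "finite S" "card S < k"
    and "a \<in> pverts A" "a \<notin> fst ` S" "b \<in> pverts B"
    and "a' \<in> pverts A" "a' \<notin> fst ` S" "b' \<in> pverts B"
  shows "((a, b), (a', b')) \<in>
    rtrancl_on (pverts A \<times> pverts B - S) (parcs (sierpinski_product A f B))"
proof -
  \<comment> \<open>\<open>S\<close> may contain pairs outside the product here, while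
    \<open>k_connectedD\<close> asks for a set of vertices of \<open>A\<close>; hence the
    intersection.\<close>
  define T where "T = pverts A \<inter> fst ` S"
  let ?R = "rtrancl_on (pverts A \<times> pverts B - S) (parcs (sierpinski_product A f B))"
  have "card T \<le> card S"
    using S by (intro surj_card_le[where f = fst]) (auto simp: T_def)
  then have "(a, a') \<in> rtrancl_on (pverts A - T) (parcs A)"
    using assms by (intro k_connectedD(3)[OF A]) (auto simp: T_def)
  \<comment> \<open>The claim covers every \<open>b'\<close> because the exit point
    \<open>(x, f y)\<close> of the fibre over \<open>x\<close> depends on the next vertex
    \<open>y\<close> of the walk in \<open>A\<close>.\<close>
  then have "\<forall>b' \<in> pverts B. ((a, b), (a', b')) \<in> ?R"
  proof (induct rule: rtrancl_on_induct)
    case base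
    then show ?case
      using assms by (auto intro!: fibre_connected[OF B S] simp: image_iff)
  next
    case (step x y)
    have y: "y \<in> pverts A" "(y, z) \<notin> S" for z
      using step by (force simp: T_def)+
    have fB: "f x \<in> pverts B" "f y \<in> pverts B"
      using f step by auto
    have "((a, b), (x, f y)) \<in> ?R"
      using step fB by blast
    then have *: "((a, b), (y, f x)) \<in> ?R"
      using step fB y
      by (auto intro: rtrancl_on_into_rtrancl_on simp: parcs_sierpinski_product_iff)
    show ?case
      using fibre_connected[OF B S] y fB rtrancl_on_trans[OF *] by blast
  qed
  then show ?thesis
    using assms by blast
qed

theorem theorem1p2:
  fixes k :: nat
    and A :: "'a pair_pre_digraph"
    and B :: "'b pair_pre_digraph"
    and f :: "'a \<Rightarrow> 'b"
  assumes "k \<ge> 1"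
    and "k_connected k A"
    and "k_connected k B"
    and "f \<in> pverts A \<rightarrow> pverts B"
    and "\<forall>a \<in> pverts A. card {f a' | a'. (a, a') \<in> parcs A} \<ge> k"
  shows "k_connected k (sierpinski_product A f B)"
proof -
  note A = assms(2) and B = assms(3) and f = assms(4)
  interpret A: pair_graph A using k_connectedD(1)[OF A] .
  let ?P = "sierpinski_product A f B"
  have P: "pair_graph ?P"
    using pair_graph_sierpinski_product k_connectedD(1) A B f by blast
  interpret P: pair_graph ?P by fact
  have "k * 1 < card (pverts A) * card (pverts B)"
    using k_connectedD(2)[OF A] k_connectedD(2)[OF B] by (intro mult_less_le_imp_less) auto
  then have card: "k < card (pverts ?P)"
    by (simp add: card_cartesian_product)
  moreover have "Digraph_Component.connected (with_proj ?P \<restriction> (pverts ?P - S))"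
    if "S \<subseteq> pverts ?P" and Sk: "card S < k" for S
    unfolding connected_induce_with_proj_iff[OF P]
  proof (intro conjI ballI)
    let ?W = "pverts A \<times> pverts B - S"
    let ?R = "rtrancl_on ?W (parcs ?P)"
    have S: "finite S"
      using that(1) P.pair_finite_verts finite_subset by blast
    show "pverts ?P - S \<noteq> {}"
      using card Sk card_mono[OF S, of "pverts ?P"] by (simp only: Diff_eq_empty_iff) linarith
    \<comment> \<open>Symmetry later reverses the walk from \<open>v\<close> to an untouched
      fibre.\<close>
    have R_sym: "sym ?R"
      using P.graph_symmetric by (intro rtrancl_on_sym symI)
    \<comment> \<open>There is no case split on whether the fibre of \<open>u\<close> is touched: in
      either case the walk moves within it to \<open>(a, f a')\<close> and crosses to
      \<open>(a', f a)\<close>, which survives since the fibre over \<open>a'\<close> is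
      untouched.\<close>
    have escape: "\<exists>x y. x \<in> pverts A \<and> x \<notin> fst ` S \<and> y \<in> pverts B \<and> (u, (x, y)) \<in> ?R"
      if u_in: "u \<in> ?W" for u
    proof -
      obtain a b where u: "u = (a, b)" "a \<in> pverts A" "b \<in> pverts B" "(a, b) \<notin> S"
        using u_in by (cases u) auto
      have "card S < card {f a' | a'. (a, a') \<in> parcs A}"
        using assms(5) u(2) Sk by fastforce
      moreover have "(a, a) \<notin> parcs A"
        using A.no_loops' by blast
      ultimately obtain a' where a': "(a, a') \<in> parcs A" "(a, f a') \<notin> S" "a' \<notin> fst ` S"
        by (rule surviving_neighbour[OF S])
      have in_verts: "a' \<in> pverts A" "f a' \<in> pverts B" "f a \<in> pverts B"
        using A.wellformed'(2)[OF a'(1)] u f by auto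
      have "(u, (a, f a')) \<in> ?R"
        using u a' in_verts fibre_connected[OF B S Sk] by blast
      moreover have "(a', f a) \<in> ?W"
        using a'(3) in_verts by force
      ultimately have "(u, (a', f a)) \<in> ?R"
        using a'(1)
        by (blast intro: rtrancl_on_into_rtrancl_on parcs_sierpinski_product_iff[THEN iffD2])
      then show ?thesis
        using a' in_verts by blast
    qed
    fix u v
    assume "u \<in> pverts ?P - S" "v \<in> pverts ?P - S"
    then obtain x y x' y'
      where xy: "x \<in> pverts A" "x \<notin> fst ` S" "y \<in> pverts B" "(u, (x, y)) \<in> ?R"
        and xy': "x' \<in> pverts A" "x' \<notin> fst ` S" "y' \<in> pverts B" "(v, (x', y')) \<in> ?R"
      using escape[of u] escape[of v] by auto
    have "((x, y), (x', y')) \<in> ?R"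
      using xy xy' untouched_fibres_connected[OF A B f S Sk] by blast
    then show "(u, v) \<in> rtrancl_on (pverts ?P - S) (parcs ?P)"
      using xy(4) symD[OF R_sym xy'(4)] by (auto intro: rtrancl_on_trans)
  qed
  ultimately show ?thesis
    using P by (auto simp: k_connected_def)
qed

end
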